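(* Let the penalty function $F(\cdot,\mu_0)$ be bounded below on $Q$, let $\{(x_n,u_n,v_n,w_n)\}$ be a sequence generated by the primal-dual rounded weighted $\ell_1$-penalty method with tolerances $\{\varepsilon_n\}$, put $\mu_n=(u_n,v_n,w_n)$ and $\varepsilon_*=\limsup_{n\to\infty}\varepsilon_n$. Suppose also that one of the following two conditions is valid: (i) there exists $s_*>0$ such that $s_n\ge s_*$ for all $n\in\mathbb{N}$; (ii) there exists a nondecreasing function $\omega\colon\mathbb{R}_+\to\mathbb{R}_+$ such that $\omega(t)>0$ for any $t>0$, and $s_n\ge\omega(\|p_n\|)$ for all $n\in\mathbb{N}$, where $\|\cdot\|$ is the Euclidean norm. Then $\operatorname{dist}(0,\Phi(x_n))=\sum_{i=1}^m|h_i(x_n)|+\sum_{j=1}^{\ell}\max\{0,g_j(x_n)\}\to0$ as $n\to\infty$ and \[ \vartheta_*\le\liminf_{n\to\infty}f(x_n)\le\limsup_{n\to\infty}f(x_n)\le\vartheta_*+\varepsilon_*, \] \[ \vartheta_*-\varepsilon_*\le\liminf_{n\to\infty}\Theta(\mu_n)\le\limsup_{n\to\infty}\Theta(\mu_n)\le\vartheta_*, \] where $\vartheta_*=\min\{f_*,\liminf_{y\to0}\beta(y)\}$. In addition, if the optimal value function $\beta$ is lower semicontinuous at the origin, then \[ \limsup_{n\to\infty}\Big(\sum_{i=1}^m u_{ni}\,\eta(h_i(x_n),w_n)+\sum_{j=1}^{\ell}v_{nj}\,\gamma(g_j(x_n),w_n)\Big)\le\varepsilon_* \] and the following statements hold: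 (1) if $h$ is continuous on $Q$, and the functions $f$ and $g_j$, $j\in\{1,\dots,\ell\}$, are lower semicontinuous on $Q$, then any limit point of $\{x_n\}$ (if such a point exists) is an $\varepsilon_*$-optimal solution of the problem of minimizing $f(x)$ subject to $h(x)=0$, $g(x)\le0$, $x\in Q$; (2) if the sequence $\{(u_n,v_n)\}$ is bounded, then the sequence $\{(u_n,v_n,w_n)\}$ converges and its limit is an $\varepsilon_*$-optimal solution of the dual problem; (3) in the case $\varepsilon_*=0$, for the boundedness of $\{(u_n,v_n)\}$ it is necessary that the $\ell_1$-penalty function $F_{\ell_1}$ is globally exact.
   Context: Setting. $(X,d_X)$ is a metric space, $Q\subset X$ is nonempty and closed, $f\colon X\to\mathbb{R}\cup\{+\infty\}$, $h=(h_1,\dots,h_m)\colon X\to\mathbb{R}^m$, $g=(g_1,\dots,g_\ell)\colon X\to\mathbb{R}^\ell$. The problem is: minimize $f(x)$ subject to $h(x)=0$, $g(x)\le0$ (coordinate-wise), $x\in Q$. Its feasible region is assumed nonempty and its optimal value $f_*$ is assumed finite. Put $\mathbb{R}_+=[0,+\infty)$, $Y=\mathbb{R}^{m+\ell}$ with the $\ell_1$-norm and $\Phi(x)=\{h(x)\}\times\{g(x)+\mathbb{R}_+^\ell\}$. The optimal value function is $\beta(y)=\inf\{f(x)\mid x\in Q,\ h_i(x)=y_i\ (1\le i\le m),\ g_j(x)\le y_{m+j}\ (1\le j\le\ell)\}$, $y\in\mathbb{R}^{m+\ell}$ ($\inf\emptyset=+\infty$), so $\beta(0)=f_*$; lower semicontinuity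 at the origin means $\beta(0)\le\liminf_{y\to0}\beta(y)$. Smoothing functions. For $w>0$: $\eta(t,w)=t^2/(2w)$ if $|t|<w$ and $\eta(t,w)=|t|-w/2$ if $|t|\ge w$; $\gamma(t,w)=0$ if $t\le0$, $\gamma(t,w)=t^2/(2w)$ if $0<t<w$, $\gamma(t,w)=t-w/2$ if $t\ge w$. Also $\eta(t,0)=|t|$, $\gamma(t,0)=\max\{0,t\}$. Rounded weighted $\ell_1$-penalty function: for $\mu=(u,v,w)\in M:=\mathbb{R}_+^m\times\mathbb{R}_+^\ell\times\mathbb{R}_+$, \[F(x,\mu)=f(x)+\sum_{i=1}^m u_i\,\eta(h_i(x),w)+\sum_{j=1}^\ell v_j\,\gamma(g_j(x),w).\] Dual function: $\Theta(\mu)=\inf_{x\in Q}F(x,\mu)$; the dual problem is to maximize $\Theta$ over $M$, with optimal value $\Theta_*$. Primal-dual rounded weighted $\ell_1$-penalty method: choose $u_0\in\mathbb{R}^m_+$, $v_0\in\mathbb{R}^\ell_+$, $w_0>0$, and a bounded above sequence $\{\varepsilon_n\}\subset[0,+\infty)$. For each $n=0,1,2,\dots$: $x_n\in Q$ satisfies $F(x_n,\mu_n)\le F(x,\mu_n)+\varepsilon_n$ for all $x\in Q$, where $\mu_n=(u_n,v_n,w_n)$, $u_n=(u_{n1},\dots,u_{nm})$, $v_n=(v_{n1},\dots,v_{n\ell})$; put $p_n=(\eta(h_1(x_n),w_n),\dots,\eta(h_m(x_n),w_n),\gamma(g_1(x_n),w_n),\dots,\gamma(g_\ell(x_n),w_n))\in\mathbb{R}^{m+\ell}$;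 choose $s_n>0$, $\delta_n\in\mathbb{R}^{m+\ell}_+$ and set $(u_{n+1},v_{n+1})=(u_n,v_n)+s_n(p_n+\delta_n)$; choose $w_{n+1}$ with $0\le w_{n+1}\le w_n$. $\ell_1$-penalty function: $F_{\ell_1}(x,c)=f(x)+c\big(\sum_{i=1}^m|h_i(x)|+\sum_{j=1}^\ell\max\{0,g_j(x)\}\big)$, $c>0$. It is called globally exact if there exists $c>0$ such that the problem of minimizing $F_{\ell_1}(x,c)$ over $x\in Q$ has the same globally optimal solutions as the original constrained problem. A limit point of a sequence is the limit of some convergent subsequence. For $\varepsilon\ge0$, an $\varepsilon$-optimal solution of the constrained problem is a feasible $x$ with $f(x)\le f_*+\varepsilon$; an $\varepsilon$-optimal solution of the dual problem is $\mu\in M$ with $\Theta(\mu)\ge\Theta_*-\varepsilon$. *)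

theory Defs
  imports "HOL-Analysis.Analysis"
begin

(* A vector of R^n is a function x :: nat => real with x i = 0 for i >= n, i.e. a point of the
   topological space Euclidean_space n; the coordinates 1, ..., n are numbered 0, ..., n - 1.
   This allows m = 0 and l = 0. *)

abbreviation rspace :: "nat \<Rightarrow> (nat \<Rightarrow> real) set" where
  "rspace n \<equiv> topspace (Euclidean_space n)"

definition orthant :: "nat \<Rightarrow> (nat \<Rightarrow> real) set" where
  "orthant n = {z \<in> rspace n. \<forall>i<n. 0 \<le> z i}"

(* the pair (a, b) in R^m x R^l, regarded as a vector of R^(m + l) *)
definition join :: "nat \<Rightarrow> (nat \<Rightarrow> real) \<Rightarrow> (nat \<Rightarrow> real) \<Rightarrow> nat \<Rightarrow> real" where
  "join m a b = (\<lambda>k. if k < m then a k else b (k - m))"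

definition l1_infdist :: "nat \<Rightarrow> (nat \<Rightarrow> real) \<Rightarrow> (nat \<Rightarrow> real) set \<Rightarrow> real" where
  "l1_infdist n a A = (INF y\<in>A. \<Sum>k<n. \<bar>a k - y k\<bar>)"

definition lsc_on :: "'a::metric_space set \<Rightarrow> ('a \<Rightarrow> ereal) \<Rightarrow> bool" where
  "lsc_on S \<phi> \<longleftrightarrow> (\<forall>z\<in>S. \<phi> z \<le> Liminf (at z within S) \<phi>)"

definition feasible ::
  "nat \<Rightarrow> nat \<Rightarrow> 'a set \<Rightarrow> ('a \<Rightarrow> nat \<Rightarrow> real) \<Rightarrow> ('a \<Rightarrow> nat \<Rightarrow> real) \<Rightarrow> 'a set" where
  "feasible m l Q h g = {x \<in> Q. (\<forall>i<m. h x i = 0) \<and> (\<forall>j<l. g x j \<le> 0)}"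

definition opt_val ::
  "nat \<Rightarrow> nat \<Rightarrow> 'a set \<Rightarrow> ('a \<Rightarrow> ereal) \<Rightarrow> ('a \<Rightarrow> nat \<Rightarrow> real) \<Rightarrow> ('a \<Rightarrow> nat \<Rightarrow> real) \<Rightarrow> ereal" where
  "opt_val m l Q f h g = (INF x\<in>feasible m l Q h g. f x)"

definition eps_optimal ::
  "nat \<Rightarrow> nat \<Rightarrow> 'a set \<Rightarrow> ('a \<Rightarrow> ereal) \<Rightarrow> ('a \<Rightarrow> nat \<Rightarrow> real) \<Rightarrow> ('a \<Rightarrow> nat \<Rightarrow> real) \<Rightarrow>
   ereal \<Rightarrow> 'a \<Rightarrow> bool" where
  "eps_optimal m l Q f h g e x \<longleftrightarrow>
     x \<in> feasible m l Q h g \<and> f x \<le> opt_val m l Q f h g + e"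

definition Phi ::
  "nat \<Rightarrow> nat \<Rightarrow> ('a \<Rightarrow> nat \<Rightarrow> real) \<Rightarrow> ('a \<Rightarrow> nat \<Rightarrow> real) \<Rightarrow> 'a \<Rightarrow> (nat \<Rightarrow> real) set" where
  "Phi m l h g x = {join m (h x) (\<lambda>j. g x j + z j) | z. z \<in> orthant l}"

definition infeas ::
  "nat \<Rightarrow> nat \<Rightarrow> ('a \<Rightarrow> nat \<Rightarrow> real) \<Rightarrow> ('a \<Rightarrow> nat \<Rightarrow> real) \<Rightarrow> 'a \<Rightarrow> real" where
  "infeas m l h g x = (\<Sum>i<m. \<bar>h x i\<bar>) + (\<Sum>j<l. max 0 (g x j))"

definition beta ::
  "nat \<Rightarrow> nat \<Rightarrow> 'a set \<Rightarrow> ('a \<Rightarrow> ereal) \<Rightarrow> ('a \<Rightarrow> nat \<Rightarrow> real) \<Rightarrow> ('a \<Rightarrow> nat \<Rightarrow> real) \<Rightarrow>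
   (nat \<Rightarrow> real) \<Rightarrow> ereal" where
  "beta m l Q f h g y =
     (INF x\<in>{x \<in> Q. (\<forall>i<m. h x i = y i) \<and> (\<forall>j<l. g x j \<le> y (m + j))}. f x)"

definition beta_liminf ::
  "nat \<Rightarrow> nat \<Rightarrow> 'a set \<Rightarrow> ('a \<Rightarrow> ereal) \<Rightarrow> ('a \<Rightarrow> nat \<Rightarrow> real) \<Rightarrow> ('a \<Rightarrow> nat \<Rightarrow> real) \<Rightarrow> ereal" where
  "beta_liminf m l Q f h g =
     Liminf (atin (Euclidean_space (m + l)) (\<lambda>_. 0)) (beta m l Q f h g)"

(* for w = 0 the last branches give |t| and max 0 t *)
definition eta :: "real \<Rightarrow> real \<Rightarrow> real" where
  "eta t w = (if \<bar>t\<bar> < w then t\<^sup>2 / (2 * w) else \<bar>t\<bar> - w / 2)"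

definition gam :: "real \<Rightarrow> real \<Rightarrow> real" where
  "gam t w = (if t \<le> 0 then 0 else if t < w then t\<^sup>2 / (2 * w) else t - w / 2)"

type_synonym multiplier = "(nat \<Rightarrow> real) \<times> (nat \<Rightarrow> real) \<times> real"

definition mults :: "nat \<Rightarrow> nat \<Rightarrow> multiplier set" where
  "mults m l = orthant m \<times> orthant l \<times> {0..}"

abbreviation mult_topology :: "nat \<Rightarrow> nat \<Rightarrow> multiplier topology" where
  "mult_topology m l \<equiv>
     prod_topology (Euclidean_space m) (prod_topology (Euclidean_space l) euclideanreal)"

definition pen_term ::
  "nat \<Rightarrow> nat \<Rightarrow> ('a \<Rightarrow> nat \<Rightarrow> real) \<Rightarrow> ('a \<Rightarrow> nat \<Rightarrow> real) \<Rightarrow> 'a \<Rightarrow> multiplier \<Rightarrow> real" where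
  "pen_term m l h g x = (\<lambda>(u, v, w).
     (\<Sum>i<m. u i * eta (h x i) w) + (\<Sum>j<l. v j * gam (g x j) w))"

definition penalty ::
  "nat \<Rightarrow> nat \<Rightarrow> ('a \<Rightarrow> ereal) \<Rightarrow> ('a \<Rightarrow> nat \<Rightarrow> real) \<Rightarrow> ('a \<Rightarrow> nat \<Rightarrow> real) \<Rightarrow>
   'a \<Rightarrow> multiplier \<Rightarrow> ereal" where
  "penalty m l f h g x \<mu> = f x + ereal (pen_term m l h g x \<mu>)"

definition dual_fun ::
  "nat \<Rightarrow> nat \<Rightarrow> 'a set \<Rightarrow> ('a \<Rightarrow> ereal) \<Rightarrow> ('a \<Rightarrow> nat \<Rightarrow> real) \<Rightarrow> ('a \<Rightarrow> nat \<Rightarrow> real) \<Rightarrow>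
   multiplier \<Rightarrow> ereal" where
  "dual_fun m l Q f h g \<mu> = (INF x\<in>Q. penalty m l f h g x \<mu>)"

definition dual_val ::
  "nat \<Rightarrow> nat \<Rightarrow> 'a set \<Rightarrow> ('a \<Rightarrow> ereal) \<Rightarrow> ('a \<Rightarrow> nat \<Rightarrow> real) \<Rightarrow> ('a \<Rightarrow> nat \<Rightarrow> real) \<Rightarrow> ereal" where
  "dual_val m l Q f h g = (SUP \<mu>\<in>mults m l. dual_fun m l Q f h g \<mu>)"

definition eps_optimal_dual ::
  "nat \<Rightarrow> nat \<Rightarrow> 'a set \<Rightarrow> ('a \<Rightarrow> ereal) \<Rightarrow> ('a \<Rightarrow> nat \<Rightarrow> real) \<Rightarrow> ('a \<Rightarrow> nat \<Rightarrow> real) \<Rightarrow>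
   ereal \<Rightarrow> multiplier \<Rightarrow> bool" where
  "eps_optimal_dual m l Q f h g e \<mu> \<longleftrightarrow>
     \<mu> \<in> mults m l \<and> dual_fun m l Q f h g \<mu> \<ge> dual_val m l Q f h g - e"

(* a vector of R^(m + l) when h x is in R^m and g x in R^l, since eta 0 w = gam 0 w = 0 for w >= 0 *)
definition pvec ::
  "nat \<Rightarrow> ('a \<Rightarrow> nat \<Rightarrow> real) \<Rightarrow> ('a \<Rightarrow> nat \<Rightarrow> real) \<Rightarrow> 'a \<Rightarrow> real \<Rightarrow> nat \<Rightarrow> real" where
  "pvec m h g x w = join m (\<lambda>i. eta (h x i) w) (\<lambda>j. gam (g x j) w)"

definition primal_dual_method ::
  "nat \<Rightarrow> nat \<Rightarrow> 'a set \<Rightarrow> ('a \<Rightarrow> ereal) \<Rightarrow> ('a \<Rightarrow> nat \<Rightarrow> real) \<Rightarrow> ('a \<Rightarrow> nat \<Rightarrow> real) \<Rightarrow>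
   (nat \<Rightarrow> real) \<Rightarrow> (nat \<Rightarrow> real) \<Rightarrow> (nat \<Rightarrow> nat \<Rightarrow> real) \<Rightarrow>
   (nat \<Rightarrow> 'a) \<Rightarrow> (nat \<Rightarrow> nat \<Rightarrow> real) \<Rightarrow> (nat \<Rightarrow> nat \<Rightarrow> real) \<Rightarrow> (nat \<Rightarrow> real) \<Rightarrow> bool" where
  "primal_dual_method m l Q f h g \<epsilon> s \<delta> x u v w \<longleftrightarrow>
     u 0 \<in> orthant m \<and> v 0 \<in> orthant l \<and> 0 < w 0 \<and>
     (\<forall>n. 0 \<le> \<epsilon> n) \<and> bdd_above (range \<epsilon>) \<and>
     (\<forall>n. u n \<in> rspace m \<and> v n \<in> rspace l) \<and>
     (\<forall>n. x n \<in> Q \<and>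
       (\<forall>z\<in>Q. penalty m l f h g (x n) (u n, v n, w n)
                 \<le> penalty m l f h g z (u n, v n, w n) + ereal (\<epsilon> n)) \<and>
       0 < s n \<and> \<delta> n \<in> orthant (m + l) \<and>
       join m (u (Suc n)) (v (Suc n)) =
         (\<lambda>k. join m (u n) (v n) k + s n * (pvec m h g (x n) (w n) k + \<delta> n k)) \<and>
       0 \<le> w (Suc n) \<and> w (Suc n) \<le> w n)"

definition l1_penalty ::
  "nat \<Rightarrow> nat \<Rightarrow> ('a \<Rightarrow> ereal) \<Rightarrow> ('a \<Rightarrow> nat \<Rightarrow> real) \<Rightarrow> ('a \<Rightarrow> nat \<Rightarrow> real) \<Rightarrow>
   'a \<Rightarrow> real \<Rightarrow> ereal" where
  "l1_penalty m l f h g x c = f x + ereal (c * infeas m l h g x)"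

definition globally_exact ::
  "nat \<Rightarrow> nat \<Rightarrow> 'a set \<Rightarrow> ('a \<Rightarrow> ereal) \<Rightarrow> ('a \<Rightarrow> nat \<Rightarrow> real) \<Rightarrow> ('a \<Rightarrow> nat \<Rightarrow> real) \<Rightarrow> bool" where
  "globally_exact m l Q f h g \<longleftrightarrow>
     (\<exists>c>0. {x. is_arg_min (\<lambda>x. l1_penalty m l f h g x c) (\<lambda>x. x \<in> Q) x}
          = {x. is_arg_min f (\<lambda>x. x \<in> feasible m l Q h g) x})"

end

theory Submission
  imports Defs
begin

text \<open>
  All constraints are merged into one vector of residuals \<open>r k\<close>, made of the \<open>h i\<close> and of the positive
  parts of the \<open>g j\<close>. The penalty term becomes \<open>\<Sum>k. c k * eta (r k) w\<close> with one weight vector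
  \<open>c = (u, v)\<close>. The function \<open>eta\<close> is nonnegative, at most \<open>\<bar>t\<bar>\<close> and nonincreasing in \<open>w\<close>. Along
  a run the weights grow and \<open>w\<close> shrinks, so the penalty functions, and with them the dual
  values, increase.

  Weak duality bounds every dual value by \<open>\<vartheta>\<close>: at a point feasible for a perturbation \<open>y\<close> the penalty
  term is at most a weighted norm of \<open>y\<close>, which vanishes as \<open>y\<close> tends to the origin
  (\<open>dual_fun_le_beta_liminf\<close>).

  The infeasibility tends to zero for a reason of accumulation. The function \<open>f\<close> plus the initial penalty
  is bounded below, and \<open>f\<close> plus the current penalty is bounded above along the run, since the
  iterates are approximate minimizers. Hence (accumulated weight) times (current smoothed residual) stays
  bounded in each coordinate (\<open>weight_products_bounded\<close>). A residual that is large infinitely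
  often would add a fixed amount to its weight infinitely often, by the assumption on the step sizes,
  and make this product unbounded (\<open>tendsto_zero_of_bounded_products\<close>).

  Once the residuals vanish in the limit, \<open>f (x n)\<close> is asymptotically at least \<open>\<vartheta>\<close>, because \<open>x n\<close> is
  feasible for the perturbation given by its own residuals (\<open>liminf_objective_ge\<close>). Approximate minimality
  gives \<open>f (x n) + penalty \<le> dual value + \<epsilon> n\<close>, and the dual value is at most \<open>\<vartheta>\<close>. The chains of limit
  inequalities and the bound on the penalty term follow by passing to the limit.

  If the multipliers are bounded, they converge by monotonicity, and the dual value at the limit dominates
  all dual values of the run (\<open>bounded_multipliers_limit\<close>). This gives dual optimality. For
  tolerances tending to zero and \<open>\<beta>\<close> lower semicontinuous at the origin it gives a penalty function
  bounded below by the optimal value, from which exactness follows since \<open>eta t w \<le> \<bar>t\<bar>\<close>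
  (\<open>globally_exact_of_dual_fun_ge\<close>).
\<close>

section \<open>The smoothing functions\<close>

lemma eta_nonneg:
  assumes "0 \<le> w"
  shows "0 \<le> eta t w"
  using assms by (auto simp: eta_def)

lemma eta_zero [simp]: "0 \<le> w \<Longrightarrow> eta 0 w = 0"
  by (auto simp: eta_def)

lemma eta_pos:
  assumes "0 \<le> w" "t \<noteq> 0"
  shows "0 < eta t w"
  using assms by (auto simp: eta_def)

lemma eta_antimono:
  assumes "0 \<le> w'" "w' \<le> w"
  shows "eta t w \<le> eta t w'"
proof -
  have less: "t\<^sup>2 / (2 * w) \<le> t\<^sup>2 / (2 * w')" if "\<bar>t\<bar> < w'"
    using that assms by (intro divide_left_mono) auto
  have mid: "t\<^sup>2 / (2 * w) \<le> \<bar>t\<bar> - w' / 2" if "w' \<le> \<bar>t\<bar>" "\<bar>t\<bar> < w"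
  proof -
    have "w * w' \<le> w * \<bar>t\<bar>"
      using that assms by (intro mult_left_mono) auto
    moreover have "\<bar>t\<bar> * \<bar>t\<bar> \<le> w * \<bar>t\<bar>"
      using that by (intro mult_right_mono) auto
    ultimately have "\<bar>t\<bar> * \<bar>t\<bar> \<le> (\<bar>t\<bar> - w' / 2) * (2 * w)"
      by (simp add: algebra_simps)
    then have "t\<^sup>2 \<le> (\<bar>t\<bar> - w' / 2) * (2 * w)"
      by (simp add: power2_eq_square)
    then show ?thesis
      using that by (simp add: pos_divide_le_eq)
  qed
  show ?thesis
    using assms less mid by (auto simp: eta_def)
qed

lemma eta_le_abs: "0 \<le> w \<Longrightarrow> eta t w \<le> \<bar>t\<bar>"
  using eta_antimono[of 0 w t] by (simp add: eta_def)

lemma eta_mono_abs: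
  assumes "0 \<le> w" "\<bar>t\<bar> \<le> \<bar>t'\<bar>"
  shows "eta t w \<le> eta t' w"
proof -
  have sq: "t\<^sup>2 \<le> t'\<^sup>2"
    using assms(2) by (simp add: abs_le_square_iff)
  have mid: "t\<^sup>2 / (2 * w) \<le> \<bar>t'\<bar> - w / 2" if "\<bar>t\<bar> < w" "w \<le> \<bar>t'\<bar>"
  proof -
    have "t\<^sup>2 \<le> w\<^sup>2"
      using that by (simp add: abs_le_square_iff[symmetric])
    then have "t\<^sup>2 / (2 * w) \<le> w\<^sup>2 / (2 * w)"
      using that by (intro divide_right_mono) auto
    also have "\<dots> = w / 2"
      using that by (simp add: power2_eq_square)
    finally show ?thesis
      using that by simp
  qed
  show ?thesis
    using assms sq mid by (auto simp: eta_def intro!: divide_right_mono)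
qed

text \<open>Since \<open>gam\<close> is \<open>eta\<close> of the positive part, equality and inequality constraints are handled
  alike from here on.\<close>

lemma gam_eq_eta: "0 \<le> w \<Longrightarrow> gam t w = eta (max 0 t) w"
  by (auto simp: gam_def eta_def max_def)

lemma tendsto_zero_of_eta:
  assumes "0 < w" "(\<lambda>n. eta (t n) w) \<longlonglongrightarrow> 0"
  shows "t \<longlonglongrightarrow> 0"
proof (rule LIMSEQ_I)
  fix e :: real
  assume "0 < e"
  then have "0 < eta e w"
    using assms(1) by (intro eta_pos) auto
  then have "eventually (\<lambda>n. eta (t n) w < eta e w) sequentially"
    using assms(2) by (rule order_tendstoD(2)[rotated])
  moreover have "\<bar>t n\<bar> < e" if "eta (t n) w < eta e w" for n
    using that eta_mono_abs[of w e "t n"] assms(1) \<open>0 < e\<close> by linarith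
  ultimately show "\<exists>N. \<forall>n\<ge>N. norm (t n - 0) < e"
    by (auto simp: eventually_sequentially)
qed


section \<open>Residuals\<close>

lemma sum_join: "(\<Sum>k<m + l. join m a b k) = (\<Sum>i<m. a i) + (\<Sum>j<l. b j)"
  by (induction l) (simp_all add: join_def)

lemma all_join: "(\<forall>k<m + l. P (join m a b k)) \<longleftrightarrow> (\<forall>i<m. P (a i)) \<and> (\<forall>j<l. P (b j))"
proof (intro iffI conjI allI impI)
  fix i assume "\<forall>k<m + l. P (join m a b k)" "i < m"
  then show "P (a i)" by (auto dest: spec[of _ i] simp: join_def)
next
  fix j assume "\<forall>k<m + l. P (join m a b k)" "j < l"
  then show "P (b j)" by (auto dest: spec[of _ "m + j"] simp: join_def)
qed (auto simp: join_def)

definition residual ::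
  "nat \<Rightarrow> ('a \<Rightarrow> nat \<Rightarrow> real) \<Rightarrow> ('a \<Rightarrow> nat \<Rightarrow> real) \<Rightarrow> 'a \<Rightarrow> nat \<Rightarrow> real" where
  "residual m h g x = join m (h x) (\<lambda>j. max 0 (g x j))"

lemma pvec_eq: "0 \<le> w \<Longrightarrow> pvec m h g x w k = eta (residual m h g x k) w"
  by (simp add: pvec_def residual_def join_def gam_eq_eta)

lemma pen_term_eq:
  assumes "0 \<le> w"
  shows "pen_term m l h g x (u, v, w) = (\<Sum>k<m + l. join m u v k * eta (residual m h g x k) w)"
proof -
  have eq: "(\<lambda>k. join m u v k * eta (residual m h g x k) w)
    = join m (\<lambda>i. u i * eta (h x i) w) (\<lambda>j. v j * gam (g x j) w)"
    using assms by (auto simp: residual_def join_def gam_eq_eta)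
  then show ?thesis
    by (simp only: eq sum_join pen_term_def prod.case)
qed

lemma infeas_eq: "infeas m l h g x = (\<Sum>k<m + l. \<bar>residual m h g x k\<bar>)"
proof -
  have eq: "(\<lambda>k. \<bar>residual m h g x k\<bar>) = join m (\<lambda>i. \<bar>h x i\<bar>) (\<lambda>j. max 0 (g x j))"
    by (auto simp: residual_def join_def)
  then show ?thesis
    by (simp only: eq sum_join infeas_def)
qed

lemma infeas_nonneg: "0 \<le> infeas m l h g x"
  by (simp add: infeas_eq sum_nonneg)

lemma feasible_iff_residual:
  "x \<in> feasible m l Q h g \<longleftrightarrow> x \<in> Q \<and> (\<forall>k<m + l. residual m h g x k = 0)"
proof -
  have "max 0 t = 0 \<longleftrightarrow> t \<le> 0" for t :: real by auto
  then show ?thesis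
    by (simp add: feasible_def residual_def all_join[where P = "\<lambda>t. t = 0"])
qed

lemma feasible_iff_infeas: "x \<in> feasible m l Q h g \<longleftrightarrow> x \<in> Q \<and> infeas m l h g x = 0"
  by (simp add: feasible_iff_residual infeas_eq sum_nonneg_eq_0_iff Ball_def)

text \<open>The nearest point to the origin in \<open>h x \<times> (g x + orthant)\<close> takes the slack
  \<open>max 0 (- g x j)\<close>, which turns the coordinate \<open>g x j\<close> into its positive part.\<close>

lemma l1_infdist_Phi:
  assumes "g x \<in> rspace l"
  shows "l1_infdist (m + l) (\<lambda>_. 0) (Phi m l h g x) = infeas m l h g x"
  unfolding l1_infdist_def
proof (rule cInf_eq_minimum)
  have "(\<lambda>j. max 0 (- g x j)) \<in> orthant l"
    using assms by (simp add: orthant_def topspace_Euclidean_space)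
  moreover have "residual m h g x = join m (h x) (\<lambda>j. g x j + max 0 (- g x j))"
    by (auto simp: residual_def join_def max_def)
  ultimately have "residual m h g x \<in> Phi m l h g x"
    unfolding Phi_def by auto
  then show "infeas m l h g x \<in> (\<lambda>y. \<Sum>k<m + l. \<bar>0 - y k\<bar>) ` Phi m l h g x"
    unfolding infeas_eq by (auto intro!: image_eqI[where x = "residual m h g x"])
next
  fix d
  assume "d \<in> (\<lambda>y. \<Sum>k<m + l. \<bar>0 - y k\<bar>) ` Phi m l h g x"
  then obtain z where z: "z \<in> orthant l"
    and d: "d = (\<Sum>k<m + l. \<bar>0 - join m (h x) (\<lambda>j. g x j + z j) k\<bar>)"
    by (auto simp: Phi_def)
  show "infeas m l h g x \<le> d"
    unfolding infeas_eq d
  proof (rule sum_mono)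
    fix k assume "k \<in> {..<m + l}"
    then have "0 \<le> z (k - m)" if "\<not> k < m"
      using z that by (simp add: orthant_def)
    then show "\<bar>residual m h g x k\<bar> \<le> \<bar>0 - join m (h x) (\<lambda>j. g x j + z j) k\<bar>"
      by (auto simp: residual_def join_def)
  qed
qed


section \<open>Monotonicity and weak duality\<close>

lemma mults_join_nonneg:
  assumes "(u, v, w) \<in> mults m l" "k < m + l"
  shows "0 \<le> join m u v k"
  using assms by (auto simp: mults_def orthant_def join_def)

lemma pen_term_mono:
  assumes "\<And>k. k < m + l \<Longrightarrow> 0 \<le> join m u v k"
    and "\<And>k. k < m + l \<Longrightarrow> join m u v k \<le> join m u' v' k"
    and "0 \<le> w'" "w' \<le> w"
  shows "pen_term m l h g x (u, v, w) \<le> pen_term m l h g x (u', v', w')"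
proof -
  have "0 \<le> w" using assms(3,4) by simp
  show ?thesis
    unfolding pen_term_eq[OF \<open>0 \<le> w\<close>] pen_term_eq[OF assms(3)]
  proof (rule sum_mono, rule mult_mono)
    fix k assume "k \<in> {..<m + l}"
    then show "join m u v k \<le> join m u' v' k" "0 \<le> join m u' v' k"
      using assms(1,2)[of k] by auto
  qed (use assms \<open>0 \<le> w\<close> in \<open>auto intro: eta_antimono eta_nonneg\<close>)
qed

lemma dual_fun_mono:
  assumes "\<And>k. k < m + l \<Longrightarrow> 0 \<le> join m u v k"
    and "\<And>k. k < m + l \<Longrightarrow> join m u v k \<le> join m u' v' k"
    and "0 \<le> w'" "w' \<le> w"
  shows "dual_fun m l Q f h g (u, v, w) \<le> dual_fun m l Q f h g (u', v', w')"
proof -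
  have "pen_term m l h g z (u, v, w) \<le> pen_term m l h g z (u', v', w')" for z
    using assms by (rule pen_term_mono)
  then show ?thesis
    unfolding dual_fun_def penalty_def by (intro INF_mono' add_left_mono) simp
qed

lemma opt_val_eq_beta: "opt_val m l Q f h g = beta m l Q f h g (\<lambda>_. 0)"
  by (simp add: opt_val_def beta_def feasible_def)

text \<open>Weak duality with an error term: a point that satisfies the constraints perturbed by \<open>y\<close> has residuals at most \<open>\<bar>y\<bar>\<close>, so its
  penalty is at most a weighted norm of \<open>y\<close>.\<close>

lemma dual_fun_le_beta:
  assumes "(u, v, w) \<in> mults m l"
  shows "dual_fun m l Q f h g (u, v, w)
    \<le> beta m l Q f h g y + ereal (\<Sum>k<m + l. join m u v k * \<bar>y k\<bar>)"
proof -
  let ?c = "\<Sum>k<m + l. join m u v k * \<bar>y k\<bar>"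
  have w: "0 \<le> w" using assms by (simp add: mults_def)
  have "dual_fun m l Q f h g (u, v, w) - ereal ?c \<le> f z"
    if z: "z \<in> Q" "\<forall>i<m. h z i = y i" "\<forall>j<l. g z j \<le> y (m + j)" for z
  proof -
    have "\<bar>residual m h g z k\<bar> \<le> \<bar>y k\<bar>" if "k < m + l" for k
    proof (cases "k < m")
      case True
      then show ?thesis using z by (simp add: residual_def join_def)
    next
      case False
      then have "g z (k - m) \<le> y k"
        using z(3)[rule_format, of "k - m"] that by simp
      then show ?thesis using False by (auto simp: residual_def join_def)
    qed
    then have "eta (residual m h g z k) w \<le> \<bar>y k\<bar>" if "k < m + l" for k
      using eta_le_abs[OF w, of "residual m h g z k"] that by force
    then have "pen_term m l h g z (u, v, w) \<le> ?c"
      unfolding pen_term_eq[OF w]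
      by (intro sum_mono mult_left_mono mults_join_nonneg[OF assms]) auto
    then have "dual_fun m l Q f h g (u, v, w) \<le> f z + ereal ?c"
      unfolding dual_fun_def penalty_def using z(1)
      by (intro INF_lower2[of z]) (auto intro: add_left_mono)
    then show ?thesis
      by (simp add: ereal_minus_le)
  qed
  then have "dual_fun m l Q f h g (u, v, w) - ereal ?c \<le> beta m l Q f h g y"
    unfolding beta_def by (intro INF_greatest) auto
  then show ?thesis
    by (simp add: ereal_minus_le)
qed

lemma limitin_Euclidean_space_iff:
  "limitin (Euclidean_space n) X L F \<longleftrightarrow>
     L \<in> rspace n \<and> eventually (\<lambda>a. X a \<in> rspace n) F \<and> (\<forall>i. ((\<lambda>a. X a i) \<longlongrightarrow> L i) F)"
  by (simp add: Euclidean_space_def limitin_subtopology limitin_componentwise)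

lemma tendsto_coordinate_atin:
  assumes "a \<in> rspace n"
  shows "((\<lambda>y. y k) \<longlongrightarrow> a k) (atin (Euclidean_space n) a)"
proof -
  have "continuous_map (Euclidean_space n) euclideanreal (\<lambda>y. y k)"
    unfolding Euclidean_space_def
    by (intro continuous_map_from_subtopology continuous_map_product_projection) auto
  then show ?thesis
    using assms by (auto simp: continuous_map_atin)
qed

text \<open>The weighted norm in the previous bound vanishes as \<open>y\<close> tends to the origin. This is why the
  dual value is limited by the lower limit of the value function and not only by its value
  at the origin.\<close>

lemma dual_fun_le_beta_liminf:
  assumes "(u, v, w) \<in> mults m l"
  shows "dual_fun m l Q f h g (u, v, w) \<le> beta_liminf m l Q f h g"
  unfolding beta_liminf_def le_Liminf_iff
proof (intro allI impI)
  fix a assume "a < dual_fun m l Q f h g (u, v, w)"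
  then obtain d where d: "a < ereal d" "ereal d < dual_fun m l Q f h g (u, v, w)"
    using ereal_dense2 by blast
  let ?F = "atin (Euclidean_space (m + l)) (\<lambda>_. 0)"
  let ?c = "\<lambda>y. \<Sum>k<m + l. join m u v k * \<bar>y k\<bar>"
  have "((\<lambda>y. y k) \<longlongrightarrow> (\<lambda>_. 0::real) k) ?F" for k
    by (rule tendsto_coordinate_atin) (simp add: topspace_Euclidean_space)
  then have "((\<lambda>y. d - ?c y) \<longlongrightarrow> d - (\<Sum>k<m + l. join m u v k * \<bar>0\<bar>)) ?F"
    by (intro tendsto_intros) auto
  then have "((\<lambda>y. ereal (d - ?c y)) \<longlongrightarrow> ereal d) ?F"
    by simp
  then have "eventually (\<lambda>y. a < ereal (d - ?c y)) ?F"
    using d(1) by (rule order_tendstoD(1))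
  moreover have "ereal (d - ?c y) \<le> beta m l Q f h g y" for y
  proof -
    have "ereal d \<le> beta m l Q f h g y + ereal (?c y)"
      using d(2) dual_fun_le_beta[OF assms, of Q f h g y] by order
    then have "ereal d - ereal (?c y) \<le> beta m l Q f h g y"
      by (subst ereal_minus_le) auto
    then show ?thesis by simp
  qed
  ultimately show "eventually (\<lambda>y. a < beta m l Q f h g y) ?F"
    by (auto elim!: eventually_mono intro: less_le_trans)
qed

lemma dual_fun_le_opt_val:
  assumes "(u, v, w) \<in> mults m l"
  shows "dual_fun m l Q f h g (u, v, w) \<le> opt_val m l Q f h g"
  using dual_fun_le_beta[OF assms, of Q f h g "\<lambda>_. 0"] by (simp add: opt_val_eq_beta)

lemma dual_val_le:
  "dual_val m l Q f h g \<le> min (opt_val m l Q f h g) (beta_liminf m l Q f h g)"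
  unfolding dual_val_def
  by (auto intro!: SUP_least dual_fun_le_opt_val dual_fun_le_beta_liminf)

text \<open>Each point is feasible for the perturbation given by its own residuals; so the
  objective value is at least the value function there. If the residuals vanish, this is the optimal
  value; otherwise it is a value at a point of a punctured neighbourhood of the origin, which is what the
  lower limit controls.\<close>

lemma liminf_objective_ge:
  assumes "\<And>n. x n \<in> Q" "\<And>z. h z \<in> rspace m" "\<And>z. g z \<in> rspace l"
    and "\<And>k. k < m + l \<Longrightarrow> (\<lambda>n. residual m h g (x n) k) \<longlonglongrightarrow> 0"
  shows "min (opt_val m l Q f h g) (beta_liminf m l Q f h g) \<le> liminf (\<lambda>n. f (x n))"
  unfolding le_Liminf_iff
proof (intro allI impI)
  fix a assume a: "a < min (opt_val m l Q f h g) (beta_liminf m l Q f h g)"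
  have beyond: "residual m h g z k = 0" if "m + l \<le> k" for z k
    using that assms(2,3)[of z] by (auto simp: residual_def join_def topspace_Euclidean_space)
  have "(\<lambda>n. residual m h g (x n) k) \<longlonglongrightarrow> 0" for k
    using assms(4)[of k] beyond[of k] by (cases "k < m + l") auto
  then have lim: "limitin (Euclidean_space (m + l)) (\<lambda>n. residual m h g (x n)) (\<lambda>_. 0) sequentially"
    by (simp add: limitin_Euclidean_space_iff topspace_Euclidean_space beyond)
  have "eventually (\<lambda>y. a < beta m l Q f h g y) (atin (Euclidean_space (m + l)) (\<lambda>_. 0))"
    using a by (auto simp: beta_liminf_def dest: less_LiminfD)
  then obtain U where U: "openin (Euclidean_space (m + l)) U" "(\<lambda>_. 0) \<in> U"
      "\<And>y. y \<in> U - {\<lambda>_. 0} \<Longrightarrow> a < beta m l Q f h g y"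
    by (auto simp: eventually_atin topspace_Euclidean_space)
  have "eventually (\<lambda>n. residual m h g (x n) \<in> U) sequentially"
    using lim U(1,2) by (auto simp: limitin_def)
  moreover have "a < f (x n)" if "residual m h g (x n) \<in> U" for n
  proof -
    have "a < beta m l Q f h g (residual m h g (x n))"
      using U(3)[of "residual m h g (x n)"] that a opt_val_eq_beta[of m l Q f h g]
      by (cases "residual m h g (x n) = (\<lambda>_. 0)") auto
    also have "\<dots> \<le> f (x n)"
      unfolding beta_def using assms(1)
      by (intro INF_lower) (auto simp: residual_def join_def)
    finally show ?thesis .
  qed
  ultimately show "eventually (\<lambda>n. a < f (x n)) sequentially"
    by (auto elim: eventually_mono)
qed


section \<open>Exactness of the penalty function\<close>

text \<open>If the penalty function with some multiplier stays above the optimal value, so does the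
  \<open>\<ell>\<^sub>1\<close>-penalty function with a coefficient \<open>c\<close> not below any weight, because
  \<open>eta t w \<le> \<bar>t\<bar>\<close>. The coefficient \<open>c + 1\<close> then charges every infeasible point an extra
  positive amount, so that no infeasible point is a minimizer.\<close>

lemma globally_exact_of_dual_fun_ge:
  assumes mult: "(u, v, w) \<in> mults m l"
    and fin: "\<bar>opt_val m l Q f h g\<bar> \<noteq> \<infinity>"
    and ge: "opt_val m l Q f h g \<le> dual_fun m l Q f h g (u, v, w)"
  shows "globally_exact m l Q f h g"
proof -
  obtain o' where o': "opt_val m l Q f h g = ereal o'"
    using fin by auto
  define c where "c = (\<Sum>k<m + l. join m u v k)"
  have w: "0 \<le> w" using mult by (simp add: mults_def)
  have nonneg: "0 \<le> join m u v k" if "k < m + l" for k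
    using mults_join_nonneg[OF mult that] .
  have c: "0 \<le> c" unfolding c_def using nonneg by (intro sum_nonneg) auto
  have le_c: "join m u v k \<le> c" if "k < m + l" for k
    unfolding c_def using nonneg that by (intro member_le_sum) auto
  have pen_le: "pen_term m l h g z (u, v, w) \<le> c * infeas m l h g z" for z
    unfolding pen_term_eq[OF w] infeas_eq sum_distrib_left using le_c nonneg c w
    by (intro sum_mono mult_mono eta_le_abs eta_nonneg) auto
  have lower: "ereal (o' + infeas m l h g z) \<le> l1_penalty m l f h g z (c + 1)" if "z \<in> Q" for z
  proof -
    have "ereal o' \<le> penalty m l f h g z (u, v, w)"
      using ge o' that unfolding dual_fun_def by (auto intro: INF_lower order_trans)
    then show ?thesis
      unfolding penalty_def l1_penalty_def using pen_le[of z]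
      by (cases "f z") (auto simp: algebra_simps)
  qed
  have feas_eq: "l1_penalty m l f h g z (c + 1) = f z" if "z \<in> feasible m l Q h g" for z
    using that by (simp add: feasible_iff_infeas l1_penalty_def zero_ereal_def[symmetric])
  have feas_ge: "ereal o' \<le> f z" if "z \<in> feasible m l Q h g" for z
    using that unfolding o'[symmetric] opt_val_def by (rule INF_lower)
  have iff: "is_arg_min (\<lambda>x. l1_penalty m l f h g x (c + 1)) (\<lambda>x. x \<in> Q) z
      \<longleftrightarrow> is_arg_min f (\<lambda>x. x \<in> feasible m l Q h g) z" for z
  proof
    assume L: "is_arg_min (\<lambda>x. l1_penalty m l f h g x (c + 1)) (\<lambda>x. x \<in> Q) z"
    then have zQ: "z \<in> Q" by (simp add: is_arg_min_def)
    have le: "l1_penalty m l f h g z (c + 1) \<le> f y" if "y \<in> feasible m l Q h g" for y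
      using L that feas_eq[OF that] by (auto simp: is_arg_min_def feasible_def not_less)
    have "l1_penalty m l f h g z (c + 1) \<le> ereal o'"
      unfolding o'[symmetric] opt_val_def using le by (intro INF_greatest)
    then have "ereal (o' + infeas m l h g z) \<le> ereal o'"
      using lower[OF zQ] by order
    then have z: "z \<in> feasible m l Q h g"
      using infeas_nonneg[of m l h g z] zQ by (simp add: feasible_iff_infeas)
    show "is_arg_min f (\<lambda>x. x \<in> feasible m l Q h g) z"
      using le feas_eq[OF z] z by (auto simp: is_arg_min_def not_less)
  next
    assume R: "is_arg_min f (\<lambda>x. x \<in> feasible m l Q h g) z"
    then have z: "z \<in> feasible m l Q h g" by (simp add: is_arg_min_def)
    have "f z \<le> f y" if "y \<in> feasible m l Q h g" for y
      using R that by (auto simp: is_arg_min_def not_less)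
    then have "f z \<le> ereal o'"
      unfolding o'[symmetric] opt_val_def by (intro INF_greatest)
    moreover have "ereal o' \<le> l1_penalty m l f h g y (c + 1)" if "y \<in> Q" for y
    proof -
      have "ereal o' \<le> ereal (o' + infeas m l h g y)"
        using infeas_nonneg[of m l h g y] by simp
      then show ?thesis using lower[OF that] by order
    qed
    ultimately show "is_arg_min (\<lambda>x. l1_penalty m l f h g x (c + 1)) (\<lambda>x. x \<in> Q) z"
      using z feas_eq[OF z]
      by (auto simp: is_arg_min_def not_less feasible_def intro: order_trans)
  qed
  show ?thesis
    unfolding globally_exact_def using c iff by (intro exI[of _ "c + 1"]) auto
qed


section \<open>Two facts on sequences\<close>

text \<open>If the terms \<open>a n\<close> exceed some \<open>e > 0\<close> infinitely often, the bound on the products keeps the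
  accumulated sum \<open>L\<close> bounded along these indices, hence everywhere because \<open>L\<close> is increasing. Then the
  increments of \<open>L\<close> tend to zero, although infinitely many of them are at least \<open>c * e\<close>.\<close>

lemma tendsto_zero_of_bounded_products:
  fixes a s L :: "nat \<Rightarrow> real"
  assumes nonneg: "\<And>n. 0 \<le> a n" "\<And>n. 0 < s n"
    and incr: "\<And>n. L n + s n * a n \<le> L (Suc n)"
    and bound: "\<And>n. (L n - L 0) * a n \<le> K"
    and steps: "\<And>e. 0 < e \<Longrightarrow> \<exists>c>0. \<forall>n. e \<le> a n \<longrightarrow> c \<le> s n"
  shows "a \<longlonglongrightarrow> 0"
proof (rule ccontr)
  assume "\<not> a \<longlonglongrightarrow> 0"
  then obtain e where e: "0 < e" and often: "\<And>N. \<exists>n\<ge>N. e \<le> a n"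
    using nonneg(1) by (auto simp: LIMSEQ_iff not_less)
  obtain c where c: "0 < c" "\<And>n. e \<le> a n \<Longrightarrow> c \<le> s n"
    using steps[OF e] by auto
  have "L n \<le> L (Suc n)" for n
    using incr[of n] mult_nonneg_nonneg[of "s n" "a n"] nonneg[of n] by linarith
  then have mono: "incseq L" by (rule incseq_SucI)
  have "L n \<le> L 0 + K / e" for n
  proof -
    obtain n' where n': "n \<le> n'" "e \<le> a n'" using often by auto
    have L: "L n \<le> L n'" "0 \<le> L n' - L 0"
      using mono n'(1) by (auto simp: incseq_def)
    have "(L n' - L 0) * e \<le> (L n' - L 0) * a n'"
      using L n' by (intro mult_left_mono) auto
    then have "(L n' - L 0) * e \<le> K" using bound[of n'] by linarith
    then have "L n' - L 0 \<le> K / e" using e by (simp add: pos_le_divide_eq)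
    then show ?thesis using L by linarith
  qed
  then obtain M where M: "L \<longlonglongrightarrow> M"
    using incseq_convergent[OF mono] by blast
  then have "(\<lambda>n. L (Suc n) - L n) \<longlonglongrightarrow> M - M"
    by (intro tendsto_diff LIMSEQ_Suc)
  then have "eventually (\<lambda>n. L (Suc n) - L n < c * e) sequentially"
    using c e by (intro order_tendstoD(2)) auto
  then obtain N where N: "\<And>n. N \<le> n \<Longrightarrow> L (Suc n) - L n < c * e"
    by (auto simp: eventually_sequentially)
  obtain n where n: "N \<le> n" "e \<le> a n" using often by auto
  have "c * e \<le> s n * a n"
    using c e n nonneg by (intro mult_mono) (auto intro: less_imp_le)
  then show False using incr[of n] N[OF n(1)] by linarith
qed

lemma lsc_on_le_liminf:
  assumes "lsc_on S \<phi>" "z \<in> S" "\<And>n. X n \<in> S" "X \<longlonglongrightarrow> z"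
  shows "\<phi> z \<le> liminf (\<lambda>n. \<phi> (X n))"
  unfolding le_Liminf_iff
proof (intro allI impI)
  fix a assume a: "a < \<phi> z"
  have "\<phi> z \<le> Liminf (at z within S) \<phi>"
    using assms(1,2) by (simp add: lsc_on_def)
  then have "eventually (\<lambda>y. a < \<phi> y) (at z within S)"
    using a by (simp add: le_Liminf_iff)
  \<comment> \<open>The lower limit ignores \<open>z\<close> itself, where the sequence may well be; there \<open>a < \<phi> z\<close> serves.\<close>
  then have "eventually (\<lambda>y. y \<in> S \<longrightarrow> a < \<phi> y) (nhds z)"
    using a by (auto simp: eventually_at_filter elim!: eventually_mono)
  then have "eventually (\<lambda>n. X n \<in> S \<longrightarrow> a < \<phi> (X n)) sequentially"
    using assms(4) by (auto simp: filterlim_iff)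
  then show "eventually (\<lambda>n. a < \<phi> (X n)) sequentially"
    using assms(3) by simp
qed


section \<open>Runs of the method\<close>

locale primal_dual_run =
  fixes m l :: nat
    and Q :: "'a::metric_space set"
    and f :: "'a \<Rightarrow> ereal"
    and h g :: "'a \<Rightarrow> nat \<Rightarrow> real"
    and \<epsilon> s w :: "nat \<Rightarrow> real"
    and x :: "nat \<Rightarrow> 'a"
    and u v \<delta> :: "nat \<Rightarrow> nat \<Rightarrow> real"
  assumes f_not_MInf: "f z \<noteq> -\<infinity>"
    and h_rspace: "h z \<in> rspace m"
    and g_rspace: "g z \<in> rspace l"
    and fin: "\<bar>opt_val m l Q f h g\<bar> \<noteq> \<infinity>"
    and bdd: "\<exists>C::real. \<forall>z\<in>Q. ereal C \<le> penalty m l f h g z (u 0, v 0, w 0)"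
    and meth: "primal_dual_method m l Q f h g \<epsilon> s \<delta> x u v w"
    and step: "(\<exists>s_low>0. \<forall>n. s_low \<le> s n) \<or>
      (\<exists>\<omega>::real \<Rightarrow> real. mono_on {0..} \<omega> \<and> (\<forall>t\<ge>0. 0 \<le> \<omega> t) \<and> (\<forall>t>0. 0 < \<omega> t) \<and>
         (\<forall>n. \<omega> (L2_set (pvec m h g (x n) (w n)) {..<m + l}) \<le> s n))"
begin

abbreviation weights :: "nat \<Rightarrow> nat \<Rightarrow> real" where
  "weights n \<equiv> join m (u n) (v n)"

abbreviation res :: "nat \<Rightarrow> nat \<Rightarrow> real" where
  "res n \<equiv> residual m h g (x n)"

abbreviation dual :: "nat \<Rightarrow> ereal" where
  "dual n \<equiv> dual_fun m l Q f h g (u n, v n, w n)"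

abbreviation pen :: "nat \<Rightarrow> real" where
  "pen n \<equiv> pen_term m l h g (x n) (u n, v n, w n)"

definition theta :: ereal where
  "theta = min (opt_val m l Q f h g) (beta_liminf m l Q f h g)"

definition eps :: ereal where
  "eps = limsup (\<lambda>n. ereal (\<epsilon> n))"

lemma x_in: "x n \<in> Q" and s_pos: "0 < s n"
  and w0_pos: "0 < w 0" and \<epsilon>_nonneg: "0 \<le> \<epsilon> n" and \<epsilon>_bdd: "bdd_above (range \<epsilon>)"
  and uv_rspace: "u n \<in> rspace m" "v n \<in> rspace l"
  using meth by (auto simp: primal_dual_method_def)

lemma w_decseq: "decseq w"
  using meth by (intro decseq_SucI) (auto simp: primal_dual_method_def)

lemma w_nonneg: "0 \<le> w n"
  using meth by (cases n) (auto simp: primal_dual_method_def)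

lemma w_le: "w n \<le> w 0"
  using w_decseq by (simp add: decseq_def)

lemma weights_Suc: "weights (Suc n) k = weights n k + s n * (eta (res n k) (w n) + \<delta> n k)"
  using meth w_nonneg[of n] unfolding primal_dual_method_def by (simp add: pvec_eq)

lemma \<delta>_nonneg: "k < m + l \<Longrightarrow> 0 \<le> \<delta> n k"
  using meth by (auto simp: primal_dual_method_def orthant_def)

lemma weights_incr:
  assumes "k < m + l"
  shows "weights n k + s n * eta (res n k) (w n) \<le> weights (Suc n) k"
  unfolding weights_Suc using \<delta>_nonneg[OF assms, of n] s_pos[of n] by (simp add: distrib_left)

lemma weights_incseq:
  assumes "k < m + l"
  shows "incseq (\<lambda>n. weights n k)"
proof (rule incseq_SucI)
  fix n
  have "0 \<le> s n * eta (res n k) (w n)"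
    using s_pos[of n] eta_nonneg[OF w_nonneg] by (intro mult_nonneg_nonneg) auto
  then show "weights n k \<le> weights (Suc n) k"
    using weights_incr[OF assms, of n] by linarith
qed

lemma weights_ge: "k < m + l \<Longrightarrow> weights 0 k \<le> weights n k"
  using weights_incseq[of k] by (simp add: incseq_def)

lemma weights_nonneg:
  assumes "k < m + l"
  shows "0 \<le> weights n k"
proof -
  have "0 \<le> weights 0 k"
    using meth assms by (auto simp: primal_dual_method_def orthant_def join_def)
  then show ?thesis using weights_ge[OF assms, of n] by linarith
qed

lemma mults: "(u n, v n, w n) \<in> mults m l"
proof -
  have "\<forall>k<m + l. 0 \<le> weights n k" using weights_nonneg by blast
  then show ?thesis
    unfolding all_join using uv_rspace[of n] w_nonneg[of n] by (simp add: mults_def orthant_def)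
qed

lemma dual_le_theta: "dual n \<le> theta"
  unfolding theta_def
  by (intro min.boundedI dual_fun_le_opt_val dual_fun_le_beta_liminf mults)

lemma dual_ge: "\<exists>C. \<forall>n. ereal C \<le> dual n"
proof -
  obtain C :: real where "\<forall>z\<in>Q. ereal C \<le> penalty m l f h g z (u 0, v 0, w 0)"
    using bdd by blast
  then have "ereal C \<le> dual 0"
    unfolding dual_fun_def by (intro INF_greatest) auto
  moreover have "dual 0 \<le> dual n" for n
    by (intro dual_fun_mono weights_nonneg weights_ge w_nonneg w_le)
  ultimately show ?thesis by (meson order_trans)
qed

lemma theta_finite: "\<bar>theta\<bar> \<noteq> \<infinity>"
proof -
  obtain C where "ereal C \<le> dual 0" using dual_ge by blast
  then have "ereal C \<le> theta" using dual_le_theta[of 0] by order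
  moreover have "theta \<le> opt_val m l Q f h g" by (simp add: theta_def)
  ultimately show ?thesis using fin by (cases theta; cases "opt_val m l Q f h g") auto
qed

lemma approx_minimal: "f (x n) + ereal (pen n) \<le> dual n + ereal (\<epsilon> n)"
proof -
  have "penalty m l f h g (x n) (u n, v n, w n) - ereal (\<epsilon> n) \<le> penalty m l f h g z (u n, v n, w n)"
    if "z \<in> Q" for z
    using meth that by (subst ereal_minus_le) (auto simp: primal_dual_method_def)
  then have "penalty m l f h g (x n) (u n, v n, w n) - ereal (\<epsilon> n) \<le> dual n"
    unfolding dual_fun_def[of m l Q f h g] by (intro INF_greatest)
  then show ?thesis
    by (subst (asm) ereal_minus_le) (auto simp: penalty_def)
qed

lemma pen_nonneg: "0 \<le> pen n"
  unfolding pen_term_eq[OF w_nonneg]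
  by (intro sum_nonneg mult_nonneg_nonneg weights_nonneg eta_nonneg w_nonneg) auto

lemma f_le: "f (x n) \<le> dual n + ereal (\<epsilon> n)"
proof -
  have "f (x n) \<le> f (x n) + ereal (pen n)"
    using pen_nonneg[of n] by (cases "f (x n)") auto
  then show ?thesis using approx_minimal[of n] by order
qed

lemma f_finite: "\<bar>f (x n)\<bar> \<noteq> \<infinity>"
proof -
  have "f (x n) \<le> theta + ereal (\<epsilon> n)"
    using f_le[of n] add_right_mono[OF dual_le_theta, of n "ereal (\<epsilon> n)"] by order
  then show ?thesis using theta_finite f_not_MInf[of "x n"] by (cases theta) auto
qed

text \<open>The value of the first penalty function at \<open>x n\<close> is bounded below, while the value of the
  current one is bounded above. Their difference dominates each product of accumulated weight and
  current smoothed residual.\<close>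

lemma weight_products_bounded:
  "\<exists>K. \<forall>n. \<forall>k<m + l. (weights n k - weights 0 k) * eta (res n k) (w n) \<le> K"
proof -
  obtain C :: real where C: "\<And>z. z \<in> Q \<Longrightarrow> ereal C \<le> penalty m l f h g z (u 0, v 0, w 0)"
    using bdd by blast
  obtain E where E: "\<And>n. \<epsilon> n \<le> E" using \<epsilon>_bdd by (auto simp: bdd_above_def)
  obtain th where th: "theta = ereal th" using theta_finite by auto
  have "(weights n k - weights 0 k) * eta (res n k) (w n) \<le> th + E - C" if k: "k < m + l" for n k
  proof -
    obtain fn where fn: "f (x n) = ereal fn" using f_finite[of n] by auto
    have "f (x n) + ereal (pen n) \<le> theta + ereal (\<epsilon> n)"
      using approx_minimal[of n] add_right_mono[OF dual_le_theta, of n "ereal (\<epsilon> n)"] by order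
    then have up: "fn + pen n \<le> th + E" using E[of n] by (simp add: fn th)
    have "pen_term m l h g (x n) (u 0, v 0, w 0) \<le> pen_term m l h g (x n) (u 0, v 0, w n)"
      by (intro pen_term_mono weights_nonneg w_nonneg w_le) auto
    then have low: "C \<le> fn + pen_term m l h g (x n) (u 0, v 0, w n)"
      using C[OF x_in, of n] by (simp add: penalty_def fn)
    have "(weights n k - weights 0 k) * eta (res n k) (w n)
        \<le> (\<Sum>k<m + l. (weights n k - weights 0 k) * eta (res n k) (w n))"
      using k weights_ge eta_nonneg[OF w_nonneg]
      by (intro member_le_sum[of k "{..<m + l}" "\<lambda>k. (weights n k - weights 0 k) * eta (res n k) (w n)"])
        (auto intro!: mult_nonneg_nonneg)
    also have "\<dots> = pen n - pen_term m l h g (x n) (u 0, v 0, w n)"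
      unfolding pen_term_eq[OF w_nonneg] by (simp add: sum_subtractf left_diff_distrib)
    finally show ?thesis using up low by linarith
  qed
  then show ?thesis by blast
qed

lemma res_tendsto:
  assumes k: "k < m + l"
  shows "(\<lambda>n. res n k) \<longlonglongrightarrow> 0"
proof -
  obtain K where K: "\<And>n. (weights n k - weights 0 k) * eta (res n k) (w n) \<le> K"
    using weight_products_bounded k by blast
  have steps: "\<exists>c>0. \<forall>n. e \<le> eta (res n k) (w n) \<longrightarrow> c \<le> s n" if e: "0 < e" for e
    using step
  proof
    assume "\<exists>s_low>0. \<forall>n. s_low \<le> s n"
    then show ?thesis by blast
  next
    assume "\<exists>\<omega>::real \<Rightarrow> real. mono_on {0..} \<omega> \<and> (\<forall>t\<ge>0. 0 \<le> \<omega> t) \<and> (\<forall>t>0. 0 < \<omega> t) \<and>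
         (\<forall>n. \<omega> (L2_set (pvec m h g (x n) (w n)) {..<m + l}) \<le> s n)"
    then obtain \<omega> :: "real \<Rightarrow> real" where \<omega>: "mono_on {0..} \<omega>" "\<And>t. 0 < t \<Longrightarrow> 0 < \<omega> t"
      "\<And>n. \<omega> (L2_set (pvec m h g (x n) (w n)) {..<m + l}) \<le> s n"
      by blast
    have "\<omega> e \<le> s n" if "e \<le> eta (res n k) (w n)" for n
    proof -
      have "e \<le> L2_set (pvec m h g (x n) (w n)) {..<m + l}"
        using member_le_L2_set[of "{..<m + l}" k "pvec m h g (x n) (w n)"] k that
        by (simp add: pvec_eq[OF w_nonneg])
      then have "\<omega> e \<le> \<omega> (L2_set (pvec m h g (x n) (w n)) {..<m + l})"
        using e by (intro mono_onD[OF \<omega>(1)]) auto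
      then show ?thesis using \<omega>(3)[of n] by linarith
    qed
    then show ?thesis using \<omega>(2)[OF e] by blast
  qed
  have "(\<lambda>n. eta (res n k) (w n)) \<longlonglongrightarrow> 0"
    by (rule tendsto_zero_of_bounded_products[where s = s and L = "\<lambda>n. weights n k",
          OF eta_nonneg[OF w_nonneg] s_pos weights_incr[OF k] K steps])
  \<comment> \<open>Passing to the fixed parameter \<open>w 0\<close>, which is positive, only makes the values smaller.\<close>
  then have "(\<lambda>n. eta (res n k) (w 0)) \<longlonglongrightarrow> 0"
    by (rule tendsto_sandwich[OF _ _ tendsto_const, rotated 2])
      (auto intro!: eventuallyI eta_nonneg eta_antimono w_nonneg w_le)
  then show ?thesis by (rule tendsto_zero_of_eta[OF w0_pos])
qed

lemma infeas_tendsto: "(\<lambda>n. infeas m l h g (x n)) \<longlonglongrightarrow> 0"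
proof -
  have "(\<lambda>n. \<Sum>k<m + l. \<bar>res n k\<bar>) \<longlonglongrightarrow> (\<Sum>k<m + l. \<bar>0\<bar>)"
    by (intro tendsto_intros res_tendsto) auto
  then show ?thesis by (simp add: infeas_eq)
qed

lemma liminf_f: "theta \<le> liminf (\<lambda>n. f (x n))"
  unfolding theta_def by (intro liminf_objective_ge x_in h_rspace g_rspace res_tendsto)

lemma eps_finite: "\<bar>eps\<bar> \<noteq> \<infinity>"
proof -
  obtain E where E: "\<And>n. \<epsilon> n \<le> E" using \<epsilon>_bdd by (auto simp: bdd_above_def)
  have "eps \<le> ereal E" unfolding eps_def using E by (intro Limsup_bounded) auto
  moreover have "0 \<le> eps" unfolding eps_def
    using \<epsilon>_nonneg by (intro le_Limsup) auto
  ultimately show ?thesis by (cases eps) auto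
qed

lemma limsup_f: "limsup (\<lambda>n. f (x n)) \<le> theta + eps"
proof -
  have "f (x n) \<le> theta + ereal (\<epsilon> n)" for n
    using f_le[of n] add_right_mono[OF dual_le_theta, of n "ereal (\<epsilon> n)"] by order
  then have "limsup (\<lambda>n. f (x n)) \<le> limsup (\<lambda>n. theta + ereal (\<epsilon> n))"
    by (intro Limsup_mono) auto
  also have "\<dots> = theta + eps"
    unfolding eps_def using theta_finite by (intro Limsup_add_ereal_left) auto
  finally show ?thesis .
qed

lemma liminf_dual: "theta - eps \<le> liminf dual"
proof -
  have "\<bar>liminf (\<lambda>n. - ereal (\<epsilon> n))\<bar> \<noteq> \<infinity>"
    unfolding ereal_Liminf_uminus eps_def[symmetric] using eps_finite by simp
  then have fin_liminf: "liminf (\<lambda>n. - ereal (\<epsilon> n)) \<noteq> \<infinity>" "liminf (\<lambda>n. - ereal (\<epsilon> n)) \<noteq> -\<infinity>"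
    by auto
  have "theta - eps \<le> liminf (\<lambda>n. f (x n)) + liminf (\<lambda>n. - ereal (\<epsilon> n))"
    unfolding ereal_Liminf_uminus eps_def[symmetric] minus_ereal_def
    using liminf_f by (rule add_right_mono)
  also have "\<dots> \<le> liminf (\<lambda>n. f (x n) + (- ereal (\<epsilon> n)))"
    using fin_liminf by (intro ereal_liminf_add_mono) auto
  also have "\<dots> \<le> liminf dual"
  proof (rule Liminf_mono, rule eventuallyI)
    fix n
    have "f (x n) - ereal (\<epsilon> n) \<le> dual n"
      using f_le[of n] by (subst ereal_minus_le) auto
    then show "f (x n) + (- ereal (\<epsilon> n)) \<le> dual n" by (simp add: minus_ereal_def)
  qed
  finally show ?thesis .
qed

lemma limsup_dual: "limsup dual \<le> theta"
  by (intro Limsup_bounded eventuallyI dual_le_theta)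

lemma limsup_pen: "limsup (\<lambda>n. ereal (pen n)) \<le> eps"
proof -
  obtain th where th: "theta = ereal th" using theta_finite by auto
  have "ereal (pen n) \<le> ereal (\<epsilon> n) + (theta + (- f (x n)))" for n
  proof -
    obtain fn where fn: "f (x n) = ereal fn" using f_finite[of n] by auto
    show ?thesis
      using approx_minimal[of n] add_right_mono[OF dual_le_theta, of n "ereal (\<epsilon> n)"]
      by (cases "dual n") (auto simp: fn th)
  qed
  then have "limsup (\<lambda>n. ereal (pen n)) \<le> limsup (\<lambda>n. ereal (\<epsilon> n) + (theta + (- f (x n))))"
    by (intro Limsup_mono) auto
  also have "\<dots> \<le> eps + limsup (\<lambda>n. theta + (- f (x n)))"
    unfolding eps_def by (rule ereal_limsup_add_mono)
  also have "limsup (\<lambda>n. theta + (- f (x n))) = theta - liminf (\<lambda>n. f (x n))"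
    using theta_finite by (simp add: Limsup_add_ereal_left ereal_Limsup_uminus minus_ereal_def)
  also have "\<dots> \<le> 0"
    using liminf_f by (cases "liminf (\<lambda>n. f (x n))") (auto simp: th)
  finally show ?thesis by (simp add: add_left_mono)
qed

lemma limit_point_eps_optimal:
  assumes "closed Q" and theta: "theta = opt_val m l Q f h g"
    and h: "continuous_map (top_of_set Q) (Euclidean_space m) h"
    and f: "lsc_on Q f" and g: "\<And>j. j < l \<Longrightarrow> lsc_on Q (\<lambda>z. ereal (g z j))"
    and r: "strict_mono r" "(x \<circ> r) \<longlonglongrightarrow> z"
  shows "eps_optimal m l Q f h g eps z"
proof -
  have xr: "(\<lambda>n. x (r n)) \<longlonglongrightarrow> z" using r(2) by (simp add: o_def)
  have z: "z \<in> Q" using assms(1) x_in xr by (rule closed_sequentially)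
  have res_r: "(\<lambda>n. res (r n) k) \<longlonglongrightarrow> 0" if "k < m + l" for k
    using LIMSEQ_subseq_LIMSEQ[OF res_tendsto[OF that] r(1)] by (simp add: o_def)
  have "h z i = 0" if i: "i < m" for i
  proof -
    have "continuous_on Q (\<lambda>y. h y i)"
      using h by (simp add: Euclidean_space_def continuous_map_in_subtopology
          continuous_map_componentwise_UNIV)
    then have "(\<lambda>n. h (x (r n)) i) \<longlonglongrightarrow> h z i"
      using continuous_on_tendsto_compose[OF _ xr z] x_in by simp
    moreover have "(\<lambda>n. h (x (r n)) i) \<longlonglongrightarrow> 0"
      using res_r[of i] i by (simp add: residual_def join_def)
    ultimately show ?thesis by (rule LIMSEQ_unique)
  qed
  moreover have "g z j \<le> 0" if j: "j < l" for j
  proof -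
    have lim: "(\<lambda>n. max 0 (g (x (r n)) j)) \<longlonglongrightarrow> 0"
      using res_r[of "m + j"] j by (simp add: residual_def join_def)
    have "ereal (g z j) \<le> liminf (\<lambda>n. ereal (g (x (r n)) j))"
      using lsc_on_le_liminf[OF g[OF j] z _ xr] x_in by simp
    also have "\<dots> \<le> liminf (\<lambda>n. ereal (max 0 (g (x (r n)) j)))"
      by (intro Liminf_mono) auto
    also have "\<dots> = ereal 0"
      using lim by (intro lim_imp_Liminf tendsto_ereal) simp_all
    finally show ?thesis by simp
  qed
  ultimately have "z \<in> feasible m l Q h g" using z by (simp add: feasible_def)
  moreover have "f z \<le> opt_val m l Q f h g + eps"
  proof -
    have "f z \<le> liminf (\<lambda>n. f (x (r n)))"
      using lsc_on_le_liminf[OF f z _ xr] x_in by simp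
    also have "\<dots> \<le> limsup (\<lambda>n. f (x (r n)))" by (intro Liminf_le_Limsup) auto
    also have "\<dots> \<le> limsup (\<lambda>n. f (x n))"
      using limsup_subseq_mono[OF r(1), of "\<lambda>n. f (x n)"] by (simp add: o_def)
    also have "\<dots> \<le> theta + eps" by (rule limsup_f)
    finally show ?thesis by (simp add: theta)
  qed
  ultimately show ?thesis by (simp add: eps_optimal_def)
qed

text \<open>Bounded multipliers converge by monotonicity, and the penalty function at the limit
  dominates the penalty functions along the run. Comparing infima carries the asymptotic lower bound on
  the dual values over to the limit.\<close>

lemma bounded_multipliers_limit:
  assumes "\<And>n. L2_set (weights n) {..<m + l} \<le> B"
  obtains us vs ws where
    "limitin (mult_topology m l) (\<lambda>n. (u n, v n, w n)) (us, vs, ws) sequentially"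
    "(us, vs, ws) \<in> mults m l"
    "theta - eps \<le> dual_fun m l Q f h g (us, vs, ws)"
proof -
  have "\<exists>L. (\<lambda>n. weights n k) \<longlonglongrightarrow> L \<and> (\<forall>n. weights n k \<le> L)" if k: "k < m + l" for k
  proof -
    have "weights n k \<le> B" for n
      using member_le_L2_set[of "{..<m + l}" k "weights n"] k assms[of n] by simp
    then show ?thesis using incseq_convergent[OF weights_incseq[OF k]] by metis
  qed
  then obtain L where L: "\<And>k. k < m + l \<Longrightarrow> (\<lambda>n. weights n k) \<longlonglongrightarrow> L k"
    "\<And>k n. k < m + l \<Longrightarrow> weights n k \<le> L k"
    by metis
  obtain ws where ws: "w \<longlonglongrightarrow> ws" "\<And>n. ws \<le> w n"
    using decseq_convergent[OF w_decseq] w_nonneg by metis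
  have ws0: "0 \<le> ws" using ws(1) w_nonneg by (auto intro: LIMSEQ_le_const)
  define us where "us = (\<lambda>i. if i < m then L i else 0)"
  define vs where "vs = (\<lambda>j. if j < l then L (m + j) else 0)"
  have join: "join m us vs k = L k" if "k < m + l" for k
    using that by (auto simp: join_def us_def vs_def)
  have L0: "0 \<le> L k" if "k < m + l" for k
    using L(2)[OF that, of 0] weights_nonneg[OF that, of 0] by linarith
  have rs: "us \<in> rspace m" "vs \<in> rspace l"
    by (auto simp: us_def vs_def topspace_Euclidean_space)
  have mult: "(us, vs, ws) \<in> mults m l"
    using ws0 rs L0 by (auto simp: mults_def orthant_def us_def vs_def)
  have "(\<lambda>n. u n i) \<longlonglongrightarrow> us i" for i
    using L(1)[of i] uv_rspace(1) by (cases "i < m") (auto simp: us_def join_def topspace_Euclidean_space)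
  moreover have "(\<lambda>n. v n j) \<longlonglongrightarrow> vs j" for j
    using L(1)[of "m + j"] uv_rspace(2)
    by (cases "j < l") (auto simp: vs_def join_def topspace_Euclidean_space)
  ultimately have lim: "limitin (mult_topology m l) (\<lambda>n. (u n, v n, w n)) (us, vs, ws) sequentially"
    using ws(1) rs uv_rspace by (simp add: limitin_pairwise limitin_Euclidean_space_iff o_def)
  have "dual n \<le> dual_fun m l Q f h g (us, vs, ws)" for n
    using join L(2) ws(2) by (intro dual_fun_mono weights_nonneg ws0) auto
  then have "limsup dual \<le> dual_fun m l Q f h g (us, vs, ws)"
    by (intro Limsup_bounded) auto
  moreover have "liminf dual \<le> limsup dual" by (intro Liminf_le_Limsup) auto
  ultimately have "theta - eps \<le> dual_fun m l Q f h g (us, vs, ws)"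
    using liminf_dual by order
  with lim mult show ?thesis by (rule that)
qed

lemma bounded_multipliers_eps_optimal:
  assumes "\<And>n. L2_set (weights n) {..<m + l} \<le> B"
  shows "\<exists>\<mu>. limitin (mult_topology m l) (\<lambda>n. (u n, v n, w n)) \<mu> sequentially \<and>
    eps_optimal_dual m l Q f h g eps \<mu>"
proof -
  obtain us vs ws where \<mu>:
    "limitin (mult_topology m l) (\<lambda>n. (u n, v n, w n)) (us, vs, ws) sequentially"
    "(us, vs, ws) \<in> mults m l" "theta - eps \<le> dual_fun m l Q f h g (us, vs, ws)"
    using bounded_multipliers_limit[OF assms] by blast
  have "dual_val m l Q f h g - eps \<le> theta - eps"
    unfolding theta_def by (intro ereal_minus_mono dual_val_le) simp
  then have "dual_val m l Q f h g - eps \<le> dual_fun m l Q f h g (us, vs, ws)"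
    using \<mu>(3) by order
  then show ?thesis using \<mu>(1,2) unfolding eps_optimal_dual_def by blast
qed

lemma bounded_multipliers_globally_exact:
  assumes "\<And>n. L2_set (weights n) {..<m + l} \<le> B"
    and "eps = 0" "theta = opt_val m l Q f h g"
  shows "globally_exact m l Q f h g"
proof -
  obtain us vs ws where "(us, vs, ws) \<in> mults m l"
    "theta - eps \<le> dual_fun m l Q f h g (us, vs, ws)"
    using bounded_multipliers_limit[OF assms(1)] by blast
  then show ?thesis
    using fin assms(2,3) by (intro globally_exact_of_dual_fun_ge) auto
qed

end

theorem theorem4:
  fixes m l :: nat
    and Q :: "'a::metric_space set"
    and f :: "'a \<Rightarrow> ereal"
    and h g :: "'a \<Rightarrow> nat \<Rightarrow> real"
    and \<epsilon> s w :: "nat \<Rightarrow> real"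
    and x :: "nat \<Rightarrow> 'a"
    and u v \<delta> :: "nat \<Rightarrow> nat \<Rightarrow> real"
    and eps theta :: ereal
  assumes Q: "Q \<noteq> {}" "closed Q"
    and f: "\<And>z. f z \<noteq> -\<infinity>"
    and h: "\<And>z. h z \<in> rspace m"
    and g: "\<And>z. g z \<in> rspace l"
    and feas: "feasible m l Q h g \<noteq> {}"
    and fin: "\<bar>opt_val m l Q f h g\<bar> \<noteq> \<infinity>"
    and bdd: "\<exists>C::real. \<forall>z\<in>Q. ereal C \<le> penalty m l f h g z (u 0, v 0, w 0)"
    and meth: "primal_dual_method m l Q f h g \<epsilon> s \<delta> x u v w"
    and step: "(\<exists>s_low>0. \<forall>n. s_low \<le> s n) \<or>
      (\<exists>\<omega>::real \<Rightarrow> real. mono_on {0..} \<omega> \<and> (\<forall>t\<ge>0. 0 \<le> \<omega> t) \<and> (\<forall>t>0. 0 < \<omega> t) \<and>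
         (\<forall>n. \<omega> (L2_set (pvec m h g (x n) (w n)) {..<m + l}) \<le> s n))"
    and eps: "eps = limsup (\<lambda>n. ereal (\<epsilon> n))"
    and theta: "theta = min (opt_val m l Q f h g) (beta_liminf m l Q f h g)"
  shows
    "(\<forall>n. l1_infdist (m + l) (\<lambda>_. 0) (Phi m l h g (x n)) = infeas m l h g (x n)) \<and>
     (\<lambda>n. infeas m l h g (x n)) \<longlonglongrightarrow> 0 \<and>
     theta \<le> liminf (\<lambda>n. f (x n)) \<and>
     liminf (\<lambda>n. f (x n)) \<le> limsup (\<lambda>n. f (x n)) \<and>
     limsup (\<lambda>n. f (x n)) \<le> theta + eps \<and>
     theta - eps \<le> liminf (\<lambda>n. dual_fun m l Q f h g (u n, v n, w n)) \<and>
     liminf (\<lambda>n. dual_fun m l Q f h g (u n, v n, w n))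
       \<le> limsup (\<lambda>n. dual_fun m l Q f h g (u n, v n, w n)) \<and>
     limsup (\<lambda>n. dual_fun m l Q f h g (u n, v n, w n)) \<le> theta \<and>
     (beta m l Q f h g (\<lambda>_. 0) \<le> beta_liminf m l Q f h g \<longrightarrow>
        limsup (\<lambda>n. ereal (pen_term m l h g (x n) (u n, v n, w n))) \<le> eps \<and>
        (continuous_map (top_of_set Q) (Euclidean_space m) h \<and> lsc_on Q f \<and>
           (\<forall>j<l. lsc_on Q (\<lambda>z. ereal (g z j))) \<longrightarrow>
         (\<forall>r xlim. strict_mono r \<and> (x \<circ> r) \<longlonglongrightarrow> xlim \<longrightarrow>
            eps_optimal m l Q f h g eps xlim)) \<and>
        ((\<exists>B. \<forall>n. L2_set (join m (u n) (v n)) {..<m + l} \<le> B) \<longrightarrow>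
         (\<exists>\<mu>. limitin (mult_topology m l) (\<lambda>n. (u n, v n, w n)) \<mu> sequentially \<and>
            eps_optimal_dual m l Q f h g eps \<mu>)) \<and>
        (eps = 0 \<and> (\<exists>B. \<forall>n. L2_set (join m (u n) (v n)) {..<m + l} \<le> B) \<longrightarrow>
         globally_exact m l Q f h g))"
proof -
  interpret run: primal_dual_run m l Q f h g \<epsilon> s w x u v \<delta>
    by unfold_locales (fact f h g fin bdd meth step)+
  have th: "theta = run.theta" and ep: "eps = run.eps"
    by (simp_all add: theta run.theta_def eps run.eps_def)
  have lsc: "run.theta = opt_val m l Q f h g"
    if "beta m l Q f h g (\<lambda>_. 0) \<le> beta_liminf m l Q f h g"
    using that by (simp add: run.theta_def opt_val_eq_beta)
  have lim_le: "liminf X \<le> limsup X" for X :: "nat \<Rightarrow> ereal"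
    by (intro Liminf_le_Limsup) auto
  show ?thesis
    unfolding th ep
  proof (intro conjI impI allI)
    fix n show "l1_infdist (m + l) (\<lambda>_. 0) (Phi m l h g (x n)) = infeas m l h g (x n)"
      using g by (rule l1_infdist_Phi)
  next
    fix r z
    assume "beta m l Q f h g (\<lambda>_. 0) \<le> beta_liminf m l Q f h g"
      and "continuous_map (top_of_set Q) (Euclidean_space m) h \<and> lsc_on Q f \<and>
           (\<forall>j<l. lsc_on Q (\<lambda>z. ereal (g z j)))"
      and "strict_mono r \<and> (x \<circ> r) \<longlonglongrightarrow> z"
    then show "eps_optimal m l Q f h g run.eps z"
      using Q(2) lsc by (intro run.limit_point_eps_optimal[of r z]) auto
  next
    assume "\<exists>B. \<forall>n. L2_set (join m (u n) (v n)) {..<m + l} \<le> B"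
    then show "\<exists>\<mu>. limitin (mult_topology m l) (\<lambda>n. (u n, v n, w n)) \<mu> sequentially \<and>
        eps_optimal_dual m l Q f h g run.eps \<mu>"
      using run.bounded_multipliers_eps_optimal by blast
  next
    assume "beta m l Q f h g (\<lambda>_. 0) \<le> beta_liminf m l Q f h g"
      and "run.eps = 0 \<and> (\<exists>B. \<forall>n. L2_set (join m (u n) (v n)) {..<m + l} \<le> B)"
    then show "globally_exact m l Q f h g"
      using lsc run.bounded_multipliers_globally_exact by blast
  qed (rule run.infeas_tendsto run.liminf_f run.limsup_f run.liminf_dual run.limsup_dual
      run.limsup_pen lim_le)+
qed

end
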